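(* Let $n,m\ge1$, $d=n+m$, $C=d\cdot d!$, and let $\alpha_1,\dots,\alpha_n,\beta_1,\dots,\beta_m$ be weight functions (as in the context). Let $\Theta\in\mathbf M_{n,m}$. Let $f:(0,\infty)\to(0,\infty)$ be continuous and strictly decreasing, and define $g(T)=1/f^{-1}(1/T)$. Suppose that $\Theta^{\top}$ is not $(f,\underline\beta,\underline\alpha)$-approximable. Then for every $\pmb\eta\in\mathbb R^n$ the following holds: for every sufficiently large $T$ there is $\mathbf q=(q_1,\dots,q_m)\in\mathbb Z^m\setminus\{\mathbf 0\}$ with $$\|\Theta_i\mathbf q-\eta_i\|\le C\,\alpha_i(g(T))\ (i=1,\dots,n),\qquad |q_j|\le C\,\beta_j(T)\ (j=1,\dots,m).$$ That is, the set of $\pmb\eta$ for which $(\Theta,\pmb\eta)$ is $(g; C\underline\alpha, C\underline\beta)$-Dirichlet is all of $\mathbb R^n$.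
   Context: A weight function is a function $h:[0,\infty)\to[0,\infty)$ such that on $[1,\infty)$ it is positive, increasing, continuous, with $h(1)=1$ and $h(T)\to\infty$, extended by $h(T)=1/h(1/T)$ for $0<T\le 1$ and $h(0)=0$. $\Theta_i$ is the $i$-th row of $\Theta$, $\|x\|$ is the distance from $x\in\mathbb R$ to the nearest integer. For $\mathbf y\in\mathbb R^n$ put $|\mathbf y|_{\underline\alpha}=\max_i\alpha_i^{-1}(|y_i|)$, and for $\mathbf x\in\mathbb R^m$ put $\|\mathbf x\|_{\underline\beta}=\min_{\mathbf p\in\mathbb Z^m}\max_j\beta_j^{-1}(|x_j-p_j|)$. The $m\times n$ matrix $\Theta^\top$ is $(f,\underline\beta,\underline\alpha)$-approximable if the inequality $\|\Theta^\top\mathbf y\|_{\underline\beta}\le f(|\mathbf y|_{\underline\alpha})$ has infinitely many solutions $\mathbf y\in\mathbb Z^n\setminus\{\mathbf 0\}$. The relation $g(T)=1/f^{-1}(1/T)$ is taken for those $T$ for which it is defined. *)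

theory Defs
  imports "HOL-Analysis.Analysis"
begin

(* "Increasing" is read strictly, since the inverse functions of weights are used throughout.
   Values at negative arguments are irrelevant. *)
definition weight_function :: "(real \<Rightarrow> real) \<Rightarrow> bool" where
  "weight_function h \<longleftrightarrow>
     (\<forall>T\<ge>1. h T > 0) \<and> strict_mono_on {1..} h \<and> continuous_on {1..} h \<and>
     h 1 = 1 \<and> filterlim h at_top at_top \<and>
     (\<forall>T. 0 < T \<and> T \<le> 1 \<longrightarrow> h T = 1 / h (1 / T)) \<and> h 0 = 0"

definition weight_inv :: "(real \<Rightarrow> real) \<Rightarrow> real \<Rightarrow> real" where
  "weight_inv h = the_inv_into {0..} h"

definition dist_nearest_int :: "real \<Rightarrow> real" where
  "dist_nearest_int x = \<bar>x - of_int (round x)\<bar>"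

definition vec_of_int :: "int ^ 'k \<Rightarrow> real ^ 'k" where
  "vec_of_int z = (\<chi> i. of_int (z $ i))"

definition weighted_abs :: "('k::finite \<Rightarrow> real \<Rightarrow> real) \<Rightarrow> real ^ 'k \<Rightarrow> real" where
  "weighted_abs w y = Max (range (\<lambda>i. weight_inv (w i) \<bar>y $ i\<bar>))"

(* The infimum is a minimum for weight functions, see weighted_int_dist_attained below. *)
definition weighted_int_dist :: "('k::finite \<Rightarrow> real \<Rightarrow> real) \<Rightarrow> real ^ 'k \<Rightarrow> real" where
  "weighted_int_dist w x = Inf (range (\<lambda>p. weighted_abs w (x - vec_of_int p)))"

(* The matrix argument A plays the role of the transpose of \<Theta>. *)
definition weighted_approximable ::
  "(real \<Rightarrow> real) \<Rightarrow> ('m::finite \<Rightarrow> real \<Rightarrow> real) \<Rightarrow> ('n::finite \<Rightarrow> real \<Rightarrow> real) \<Rightarrow> real ^ 'n ^ 'm \<Rightarrow> bool"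
where
  "weighted_approximable f \<beta> \<alpha> A \<longleftrightarrow>
     infinite {y :: int ^ 'n. y \<noteq> 0 \<and>
       weighted_int_dist \<beta> (A *v vec_of_int y) \<le> f (weighted_abs \<alpha> (vec_of_int y))}"

(* g T = 1 / f\<^sup>-\<^sup>1 (1 / T) for T in the domain dual_dom f, and unspecified elsewhere. *)
definition dual_dom :: "(real \<Rightarrow> real) \<Rightarrow> real set" where
  "dual_dom f = {T. T > 0 \<and> 1 / T \<in> f ` {0<..}}"

definition dual_fun :: "(real \<Rightarrow> real) \<Rightarrow> real \<Rightarrow> real" where
  "dual_fun f T = 1 / the_inv_into {0<..} f (1 / T)"

(* D is the domain of the partial function g. *)
definition weighted_dirichlet ::
  "real set \<Rightarrow> (real \<Rightarrow> real) \<Rightarrow> ('n::finite \<Rightarrow> real \<Rightarrow> real) \<Rightarrow> ('m::finite \<Rightarrow> real \<Rightarrow> real) \<Rightarrow>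
     real ^ 'm ^ 'n \<Rightarrow> real ^ 'n \<Rightarrow> bool"
where
  "weighted_dirichlet D g \<alpha> \<beta> \<Theta> \<eta> \<longleftrightarrow>
     (\<forall>\<^sub>F T in at_top. T \<in> D \<longrightarrow>
       (\<exists>q :: int ^ 'm. q \<noteq> 0 \<and>
          (\<forall>i. dist_nearest_int ((\<Theta> *v vec_of_int q) $ i - \<eta> $ i) \<le> \<alpha> i (g T)) \<and>
          (\<forall>j. \<bar>of_int (q $ j)\<bar> \<le> \<beta> j T)))"

lemma weight_function_strict_mono_on:
  assumes "weight_function h"
  shows "strict_mono_on {0..} h"
proof (rule strict_mono_onI)
  fix x y :: real
  assume xy: "x \<in> {0..}" "y \<in> {0..}" "x < y"
  have mono: "h s < h t" if "1 \<le> s" "s < t" for s t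
    using assms that strict_mono_onD[of "{1..}" h s t] by (auto simp: weight_function_def)
  have pos: "h t > 0" if "t \<ge> 1" for t
    using assms that by (auto simp: weight_function_def)
  have small: "h t = 1 / h (1 / t)" if "0 < t" "t \<le> 1" for t
    using assms that by (auto simp: weight_function_def)
  have h01: "h 0 = 0" "h 1 = 1"
    using assms by (auto simp: weight_function_def)
  have small_pos: "h t > 0" if "0 < t" "t \<le> 1" for t
    using small[OF that] pos[of "1 / t"] that by simp
  consider "x = 0" | "0 < x" "y \<le> 1" | "0 < x" "x \<le> 1" "1 < y" | "1 < x"
    using xy by fastforce
  then show "h x < h y"
  proof cases
    case 1
    then show ?thesis using h01 pos small_pos xy by (cases "y \<le> 1") auto
  next
    case 2
    have "h (1 / y) < h (1 / x)"
      using 2 xy by (intro mono) (auto simp: field_simps)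
    then show ?thesis
      using 2 xy small[of x] small[of y] pos[of "1 / y"] by (simp add: frac_less2)
  next
    case 3
    have "h (1 / x) \<ge> 1"
      using 3 h01 mono[of 1 "1 / x"] by (cases "x = 1") auto
    then have "h x \<le> 1" using small[of x] 3 by simp
    also have "1 < h y" using mono[of 1 y] 3 h01 by simp
    finally show ?thesis .
  next
    case 4
    then show ?thesis using mono xy by simp
  qed
qed

lemma weight_function_bij_betw:
  assumes "weight_function h"
  shows "bij_betw h {0..} {0..}"
proof -
  have sm: "strict_mono_on {0..} h"
    by (rule weight_function_strict_mono_on[OF assms])
  have h01: "h 0 = 0" "h 1 = 1" and lim: "filterlim h at_top at_top"
    and cont: "continuous_on {1..} h"
    and small: "\<And>t. 0 < t \<Longrightarrow> t \<le> 1 \<Longrightarrow> h t = 1 / h (1 / t)"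
    using assms by (auto simp: weight_function_def)
  have nonneg: "h x \<ge> 0" if "x \<ge> 0" for x
    using strict_mono_onD[OF sm, of 0 x] that h01 by (cases "x = 0") auto
  have big: "\<exists>x\<ge>1. h x = t" if t: "t \<ge> 1" for t
  proof -
    obtain N where N: "\<And>x. x \<ge> N \<Longrightarrow> h x \<ge> t"
      using lim by (auto simp: filterlim_at_top eventually_at_top_linorder)
    have "\<exists>x\<ge>1. x \<le> max 1 N \<and> h x = t"
      using t h01 N[of "max 1 N"] cont
      by (intro IVT') (auto intro: continuous_on_subset)
    then show ?thesis by blast
  qed
  have "t \<in> h ` {0..}" if t: "t \<ge> 0" for t
  proof -
    consider "t = 0" | "0 < t" "t < 1" | "t \<ge> 1" using t by fastforce
    then show ?thesis
    proof cases
      case 1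
      then show ?thesis using h01 by (auto intro!: image_eqI[of _ _ 0])
    next
      case 2
      then obtain x where x: "x \<ge> 1" "h x = 1 / t" using big[of "1 / t"] by auto
      then have "h (1 / x) = t" using small[of "1 / x"] 2 by simp
      then show ?thesis using x by (auto intro!: image_eqI[of _ _ "1 / x"])
    next
      case 3
      then obtain x where "x \<ge> 1" "h x = t" using big by auto
      then show ?thesis by (auto intro!: image_eqI[of _ _ x])
    qed
  qed
  then have "h ` {0..} = {0..}" using nonneg by auto
  then show ?thesis
    using strict_mono_on_imp_inj_on[OF sm] by (simp add: bij_betw_def)
qed

lemma weight_inv_mono:
  assumes "weight_function h" and "0 \<le> s" and "s \<le> t"
  shows "weight_inv h s \<le> weight_inv h t"
proof (rule ccontr)
  have bij: "bij_betw h {0..} {0..}" and sm: "strict_mono_on {0..} h"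
    using assms(1) by (rule weight_function_bij_betw weight_function_strict_mono_on)+
  have inv: "h (weight_inv h u) = u \<and> weight_inv h u \<in> {0..}" if "u \<ge> 0" for u
    using bij that f_the_inv_into_f_bij_betw[OF bij, of u] the_inv_into_into[of h "{0..}" u "{0..}"]
    by (auto simp: weight_inv_def bij_betw_def)
  assume "\<not> weight_inv h s \<le> weight_inv h t"
  then have "h (weight_inv h t) < h (weight_inv h s)"
    using inv[of s] inv[of t] assms by (intro strict_mono_onD[OF sm]) auto
  then show False using inv[of s] inv[of t] assms by auto
qed

lemma weighted_int_dist_attained:
  fixes w :: "'k::finite \<Rightarrow> real \<Rightarrow> real"
  assumes "\<And>i. weight_function (w i)"
  shows "\<exists>p. weighted_int_dist w x = weighted_abs w (x - vec_of_int p)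
           \<and> (\<forall>p'. weighted_abs w (x - vec_of_int p) \<le> weighted_abs w (x - vec_of_int p'))"
proof -
  define p :: "int ^ 'k" where "p = (\<chi> i. round (x $ i))"
  have le: "weighted_abs w (x - vec_of_int p) \<le> weighted_abs w (x - vec_of_int p')" for p'
  proof -
    have "weight_inv (w i) \<bar>(x - vec_of_int p) $ i\<bar> \<le> weight_inv (w i) \<bar>(x - vec_of_int p') $ i\<bar>" for i
      using round_diff_minimal[of "x $ i" "p' $ i"]
      by (intro weight_inv_mono assms) (auto simp: p_def vec_of_int_def)
    then have "weight_inv (w i) \<bar>(x - vec_of_int p) $ i\<bar> \<le> weighted_abs w (x - vec_of_int p')" for i
      unfolding weighted_abs_def by (rule order_trans) (intro Max_ge, auto)
    then show ?thesis
      unfolding weighted_abs_def[of w "x - vec_of_int p"] by (intro Max.boundedI) auto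
  qed
  then have "weighted_int_dist w x = weighted_abs w (x - vec_of_int p)"
    unfolding weighted_int_dist_def by (intro cInf_eq_minimum) auto
  with le show ?thesis by auto
qed

end

theory Submission
  imports Defs
begin

text \<open>Put \<open>X = 1 / g T\<close>, so that \<open>f X = 1 / T\<close>. Non-approximability says that, for large
  \<open>T\<close>, the box with sides \<open>\<alpha>\<^sub>i X\<close> and \<open>1 / \<beta>\<^sub>j T\<close> contains no nonzero point
  \<open>(y, \<Theta>\<^sup>T y - z)\<close>: an exceptional \<open>y\<close> would lie in a fixed finite set and satisfy
  \<open>\<Theta>\<^sup>T y \<in> \<int>\<^sup>m\<close>, but then all its multiples would be solutions. After rescaling, the
  dual lattice has minimal norm at least 1, and an elementary transference bound gives the original
  lattice a covering radius of at most \<open>2\<^sup>d / \<surd>12\<close>, which is less than \<open>C / 2\<close>.\<close>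

section \<open>Subgroups with positive minimal norm and characters modulo the integers\<close>

text \<open>The elements of \<open>M\<close> at which \<open>\<phi>\<close> is integral are closed
  under subtraction, so they form a subgroup. With \<open>\<phi> = 0\<close> this reduces to closure
  of \<open>M\<close> under integer multiples.\<close>

lemma subgroup_multiples:
  fixes M :: "'a::real_vector set" and \<phi> :: "'a \<Rightarrow> real" and k :: int
  assumes zero: "0 \<in> M" and diff: "\<And>u v. u \<in> M \<Longrightarrow> v \<in> M \<Longrightarrow> u - v \<in> M"
    and hom: "\<And>u v. u \<in> M \<Longrightarrow> v \<in> M \<Longrightarrow> \<phi> (u - v) - (\<phi> u - \<phi> v) \<in> \<int>"
    and v: "v \<in> M" and \<phi>v: "\<phi> v \<in> \<int>"
  shows "of_int k *\<^sub>R v \<in> M \<and> \<phi> (of_int k *\<^sub>R v) \<in> \<int>"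
proof -
  have step: "x - y \<in> M \<and> \<phi> (x - y) \<in> \<int>" 
    if "x \<in> M \<and> \<phi> x \<in> \<int>" "y \<in> M \<and> \<phi> y \<in> \<int>" for x y
    using Ints_add[OF hom[of x y] Ints_diff[of "\<phi> x" "\<phi> y"]] diff that by auto
  have 0: "0 \<in> M \<and> \<phi> 0 \<in> \<int>" 
    using hom[OF zero zero] zero by simp
  have neg: "- v \<in> M \<and> \<phi> (- v) \<in> \<int>" 
    using step[OF 0, of v] v \<phi>v by simp
  show ?thesis
  proof (induction k rule: int_induct[where k = 0])
    case base
    then show ?case using 0 by simp
  next
    case (step1 i)
    then show ?case using step[OF step1(2) neg] by (simp add: algebra_simps)
  next
    case (step2 i)
    then show ?case using step[OF step2(2), of v] v \<phi>v by (simp add: algebra_simps)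
  qed
qed

text \<open>The infimum of the squared norms is positive, hence strictly below its double, so some
  element lies under that double. The factor 2 spares a compactness argument for an exact
  minimum.\<close>

lemma nearly_shortest_vector:
  fixes M :: "'a::real_normed_vector set"
  assumes r: "r > 0" and min: "\<And>w. w \<in> M \<Longrightarrow> w \<noteq> 0 \<Longrightarrow> r \<le> norm w"
    and ne: "\<exists>w\<in>M. w \<noteq> 0"
  obtains v where "v \<in> M" "v \<noteq> 0" "\<And>w. w \<in> M \<Longrightarrow> w \<noteq> 0 \<Longrightarrow> (norm v)\<^sup>2 \<le> 2 * (norm w)\<^sup>2"
proof -
  define A where "A = (\<lambda>w. (norm w)\<^sup>2) ` (M - {0})"
  have Ane: "A \<noteq> {}" using ne by (auto simp: A_def)
  have lower: "r\<^sup>2 \<le> a" if "a \<in> A" for a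
    using that min r by (auto simp: A_def intro!: power_mono)
  then have bdd: "bdd_below A" by (rule bdd_belowI)
  have "0 < r\<^sup>2" using r by simp
  also have "r\<^sup>2 \<le> Inf A" using Ane lower by (rule cInf_greatest)
  finally have "Inf A < 2 * Inf A" by simp
  then obtain a where a: "a \<in> A" "a < 2 * Inf A"
    using cInf_lessD[OF Ane] by blast
  then obtain v where v: "v \<in> M" "v \<noteq> 0" "a = (norm v)\<^sup>2" by (auto simp: A_def)
  show ?thesis
  proof (rule that[OF v(1,2)])
    fix w assume "w \<in> M" "w \<noteq> 0"
    then have "Inf A \<le> (norm w)\<^sup>2" using bdd by (intro cInf_lower) (auto simp: A_def)
    then show "(norm v)\<^sup>2 \<le> 2 * (norm w)\<^sup>2" using a v by linarith
  qed
qed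

text \<open>For \<open>\<phi> = (\<bullet>) t\<close> this says that the dual lattice of \<open>M\<close> has a point close to \<open>t\<close>. The
  character form is what survives the induction without choosing lattice bases: project orthogonally
  to a nearly shortest \<open>v\<close>; any \<open>w \<in> M\<close> can be shifted by a multiple of \<open>v\<close> so that its
  component along \<open>v\<close> is at most \<open>norm v / 2\<close>, hence the minimal norm at most halves, and a
  multiple of \<open>v\<close> corrects \<open>\<phi>\<close> so that it descends to the projection.\<close>

lemma character_short_representative:
  fixes M :: "'a::euclidean_space set" and \<phi> :: "'a \<Rightarrow> real"
  assumes "0 \<in> M" and "\<And>u v. u \<in> M \<Longrightarrow> v \<in> M \<Longrightarrow> u - v \<in> M"
    and "\<And>u v. u \<in> M \<Longrightarrow> v \<in> M \<Longrightarrow> \<phi> (u - v) - (\<phi> u - \<phi> v) \<in> \<int>"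
    and "r > 0" and "\<And>w. w \<in> M \<Longrightarrow> w \<noteq> 0 \<Longrightarrow> r \<le> norm w"
    and "dim M \<le> k"
  shows "\<exists>x\<in>span M. (\<forall>w\<in>M. x \<bullet> w - \<phi> w \<in> \<int>) \<and> (norm x)\<^sup>2 \<le> (4 ^ k - 1) / (12 * r\<^sup>2)"
  using assms
proof (induction k arbitrary: M \<phi> r)
  case 0
  have "\<phi> 0 \<in> \<int>" using 0(3)[OF 0(1) 0(1)] by simp
  moreover have "M \<subseteq> {0}" using 0 by simp
  ultimately show ?case by (auto intro!: bexI[of _ 0] simp: span_zero)
next
  case (Suc k)
  note zero = Suc.prems(1) and diff = Suc.prems(2) and hom = Suc.prems(3)
    and r = Suc.prems(4) and min = Suc.prems(5) and dimM = Suc.prems(6)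
  show ?case
  proof (cases "\<exists>w\<in>M. w \<noteq> 0")
    case False
    have "\<phi> 0 \<in> \<int>" using hom[OF zero zero] by simp
    moreover have "(1::real) \<le> 4 ^ Suc k" by (rule one_le_power) simp
    ultimately show ?thesis using False r
      by (auto intro!: bexI[of _ 0] divide_nonneg_nonneg simp: span_zero)
  next
    case True
    obtain v where v: "v \<in> M" "v \<noteq> 0"
      and short: "\<And>w. w \<in> M \<Longrightarrow> w \<noteq> 0 \<Longrightarrow> (norm v)\<^sup>2 \<le> 2 * (norm w)\<^sup>2"
      using nearly_shortest_vector[OF r min True] by metis
    have vv: "v \<bullet> v > 0" using v by simp
    define s where "s w = (w \<bullet> v) / (v \<bullet> v)" for w
    define \<pi> where "\<pi> w = w - s w *\<^sub>R v" for w
    have \<pi>_orth: "\<pi> w \<bullet> v = 0" for w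
      using vv by (simp add: \<pi>_def s_def inner_diff_left)
    have \<pi>_diff: "\<pi> (u - w) = \<pi> u - \<pi> w" for u w
      by (simp add: \<pi>_def s_def inner_diff_left diff_divide_distrib algebra_simps)
    have multM: "of_int j *\<^sub>R v \<in> M" for j
      using subgroup_multiples[of M "\<lambda>_. 0" v j] zero diff v by auto
    have decomp: "(norm (w - of_int j *\<^sub>R v))\<^sup>2 = (norm (\<pi> w))\<^sup>2 + (s w - of_int j)\<^sup>2 * (norm v)\<^sup>2" for w j
    proof -
      have eq: "w - of_int j *\<^sub>R v = \<pi> w + (s w - of_int j) *\<^sub>R v"
        by (simp add: \<pi>_def algebra_simps)
      have "orthogonal (\<pi> w) ((s w - of_int j) *\<^sub>R v)"
        using \<pi>_orth by (simp add: orthogonal_def)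
      from norm_add_Pythagorean[OF this] show ?thesis
        unfolding eq by (simp add: power_mult_distrib)
    qed
    \<comment> \<open>Rounding leaves at most a quarter of the squared norm of \<open>v\<close>
      along \<open>v\<close>, while near-minimality gives the shifted vector at least half of it;
      the remaining quarter must come from \<open>\<pi> w\<close>.\<close>
    have reduce: "(norm v)\<^sup>2 / 4 \<le> (norm (\<pi> w))\<^sup>2" 
      if w: "w \<in> M" and nz: "w - of_int (round (s w)) *\<^sub>R v \<noteq> 0" for w
    proof -
      have "\<bar>s w - of_int (round (s w))\<bar> \<le> 1 / 2"
        using of_int_round_abs_le[of "s w"] by (simp add: abs_minus_commute)
      then have "(s w - of_int (round (s w)))\<^sup>2 \<le> (1 / 2)\<^sup>2"
        by (rule power2_le_iff_abs_le[THEN iffD2, rotated]) simp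
      then have "(s w - of_int (round (s w)))\<^sup>2 * (norm v)\<^sup>2 \<le> 1 / 4 * (norm v)\<^sup>2"
        by (intro mult_right_mono) (auto simp: power2_eq_square)
      moreover have "(norm v)\<^sup>2 \<le> 2 * (norm (w - of_int (round (s w)) *\<^sub>R v))\<^sup>2"
        using short[OF diff[OF w multM] nz] .
      ultimately show ?thesis using decomp[of w "round (s w)"] by linarith
    qed
    \<comment> \<open>On \<open>M\<close> the kernel of \<open>\<pi>\<close> is exactly the integer
      multiples of \<open>v\<close>: any other element of it would force \<open>v = 0\<close> by
      \<open>reduce\<close>.\<close>
    have ker: "w = of_int (round (s w)) *\<^sub>R v" if w: "w \<in> M" "\<pi> w = 0" for w
    proof (rule ccontr)
      assume "\<not> ?thesis"
      then have "(norm v)\<^sup>2 / 4 \<le> 0" using reduce[of w] w by simp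
      then show False using v by simp
    qed
    \<comment> \<open>\<open>x0\<close> is the multiple of \<open>v\<close> with
      \<open>x0 \<bullet> v = c\<close>, where \<open>c\<close> is the signed distance of
      \<open>\<phi> v\<close> to the nearest integer. Subtracting its pairing makes the character
      integral at \<open>v\<close> at the smallest cost in norm.\<close>
    define c where "c = \<phi> v - of_int (round (\<phi> v))"
    define x0 where "x0 = (c / (v \<bullet> v)) *\<^sub>R v"
    define \<phi>1 where "\<phi>1 w = \<phi> w - x0 \<bullet> w" for w
    have hom1: "\<phi>1 (u - w) - (\<phi>1 u - \<phi>1 w) \<in> \<int>" if "u \<in> M" "w \<in> M" for u w
      using hom[OF that] by (simp add: \<phi>1_def inner_diff_right algebra_simps)
    have \<phi>1v: "\<phi>1 v \<in> \<int>" using vv by (simp add: \<phi>1_def x0_def c_def)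
    \<comment> \<open>Modulo integers \<open>\<phi>1\<close> depends only on the projection, because
      it is integral on the kernel of \<open>\<pi>\<close>; this is what lets it descend.\<close>
    have \<phi>1_cong: "\<phi>1 u - \<phi>1 w \<in> \<int>" if uw: "u \<in> M" "w \<in> M" "\<pi> u = \<pi> w" for u w
    proof -
      have "\<pi> (u - w) = 0" using uw \<pi>_diff by simp
      then have "u - w = of_int (round (s (u - w))) *\<^sub>R v" using ker diff uw by blast
      then have "\<phi>1 (u - w) \<in> \<int>"
        using subgroup_multiples[OF zero diff hom1 v(1) \<phi>1v] by metis
      from Ints_diff[OF this hom1[OF uw(1,2)]] show ?thesis by simp
    qed
    \<comment> \<open>The section is arbitrary and need not be additive;
      \<open>\<phi>1 \<circ> \<sigma>\<close> is still additive modulo integers, by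
      \<open>\<phi>1_cong\<close>.\<close>
    define \<sigma> where "\<sigma> u = (SOME w. w \<in> M \<and> \<pi> w = u)" for u
    have \<sigma>: "\<sigma> u \<in> M \<and> \<pi> (\<sigma> u) = u" if "u \<in> \<pi> ` M" for u
      unfolding \<sigma>_def by (rule someI_ex) (use that in auto)
    have x0: "(norm x0)\<^sup>2 \<le> 1 / (4 * r\<^sup>2)"
    proof -
      have "c\<^sup>2 \<le> (1 / 2)\<^sup>2" unfolding c_def
        using of_int_round_abs_le[of "\<phi> v"] by (intro power2_le_iff_abs_le[THEN iffD2]) (auto simp: abs_minus_commute)
      moreover have "r\<^sup>2 \<le> (norm v)\<^sup>2" using min[OF v] r by (intro power_mono) auto
      moreover have "(norm x0)\<^sup>2 = c\<^sup>2 / (norm v)\<^sup>2"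
        using v by (simp add: x0_def power_mult_distrib power_divide power2_norm_eq_inner[symmetric] field_simps power2_eq_square)
      ultimately have "(norm x0)\<^sup>2 \<le> (1/2)\<^sup>2 / r\<^sup>2" using r by (auto intro!: frac_le)
      then show ?thesis by (simp add: power2_eq_square)
    qed
    have sub: "\<pi> ` M \<subseteq> span M"
      using v by (auto simp: \<pi>_def intro: span_diff span_scale span_base)
    have "\<exists>x\<in>span (\<pi> ` M). (\<forall>u\<in>\<pi> ` M. x \<bullet> u - (\<phi>1 \<circ> \<sigma>) u \<in> \<int>) \<and>
            (norm x)\<^sup>2 \<le> (4 ^ k - 1) / (12 * (r / 2)\<^sup>2)"
    proof (rule Suc.IH)
      show "0 \<in> \<pi> ` M" using zero by (auto intro!: image_eqI[of _ _ 0] simp: \<pi>_def s_def)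
      show diff': "u - w \<in> \<pi> ` M" if "u \<in> \<pi> ` M" "w \<in> \<pi> ` M" for u w
        using that diff by (auto simp: \<pi>_diff[symmetric])
      show "(\<phi>1 \<circ> \<sigma>) (u - w) - ((\<phi>1 \<circ> \<sigma>) u - (\<phi>1 \<circ> \<sigma>) w) \<in> \<int>"
        if uw: "u \<in> \<pi> ` M" "w \<in> \<pi> ` M" for u w
      proof -
        note \<sigma>s = \<sigma>[OF uw(1)] \<sigma>[OF uw(2)] \<sigma>[OF diff'[OF uw]]
        have "\<phi>1 (\<sigma> (u - w)) - \<phi>1 (\<sigma> u - \<sigma> w) \<in> \<int>"
          using \<sigma>s diff by (intro \<phi>1_cong) (auto simp: \<pi>_diff)
        from Ints_add[OF this hom1[of "\<sigma> u" "\<sigma> w"]] \<sigma>s show ?thesis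
          by (simp add: algebra_simps)
      qed
      show "r / 2 > 0" using r by simp
      show "r / 2 \<le> norm u" if u: "u \<in> \<pi> ` M" "u \<noteq> 0" for u
      proof -
        obtain w where w: "w \<in> M" "u = \<pi> w" using u by auto
        \<comment> \<open>If the shifted vector vanished, the Pythagorean identity
          \<open>decomp\<close> would give \<open>\<pi> w = 0\<close>.\<close>
        have "w - of_int (round (s w)) *\<^sub>R v \<noteq> 0"
          using decomp[of w "round (s w)"] u w by (auto simp: sum_power2_eq_zero_iff add_nonneg_eq_0_iff)
        then have "(norm v)\<^sup>2 / 4 \<le> (norm u)\<^sup>2" using reduce w by simp
        then have "(norm v / 2)\<^sup>2 \<le> (norm u)\<^sup>2" by (simp add: power_divide)
        then have "norm v / 2 \<le> norm u" by (rule power2_le_imp_le) simp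
        then show ?thesis using min[OF v] by simp
      qed
      \<comment> \<open>The dimension drops because everything in the span of the projection is
        orthogonal to \<open>v\<close>, whereas \<open>v\<close> is not orthogonal to
        itself.\<close>
      have "v \<notin> span (\<pi> ` M)"
      proof
        assume "v \<in> span (\<pi> ` M)"
        then have "v \<bullet> v = 0" 
          by (rule span_induct) (use \<pi>_orth in \<open>auto simp: subspace_def inner_add_left\<close>)
        then show False using vv by simp
      qed
      moreover have "v \<in> span M" using v by (auto intro: span_base)
      ultimately have "span (\<pi> ` M) \<subset> span M" using span_minimal[OF sub] by auto
      then have "dim (\<pi> ` M) < dim M" by (rule dim_psubset)
      then show "dim (\<pi> ` M) \<le> k" using dimM by simp
    qed
    then obtain x where x: "x \<in> span (\<pi> ` M)" "\<And>w. w \<in> M \<Longrightarrow> x \<bullet> \<pi> w - \<phi>1 (\<sigma> (\<pi> w)) \<in> \<int>"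
      and nx: "(norm x)\<^sup>2 \<le> (4 ^ k - 1) / (12 * (r / 2)\<^sup>2)" by auto
    have xv: "x \<bullet> v = 0" using x(1)
      by (rule span_induct) (use \<pi>_orth in \<open>auto simp: subspace_def inner_add_left\<close>)
    show ?thesis
    proof (intro bexI[of _ "x + x0"] conjI ballI)
      fix w assume w: "w \<in> M"
      have "\<phi>1 (\<sigma> (\<pi> w)) - \<phi>1 w \<in> \<int>"
        using \<sigma>[of "\<pi> w"] w by (intro \<phi>1_cong) auto
      from Ints_add[OF x(2)[OF w] this]
      show "(x + x0) \<bullet> w - \<phi> w \<in> \<int>"
        using xv by (simp add: \<phi>1_def \<pi>_def inner_diff_right inner_add_left algebra_simps)
    next
      have "orthogonal x x0" using xv by (simp add: orthogonal_def x0_def)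
      then have "(norm (x + x0))\<^sup>2 = (norm x)\<^sup>2 + (norm x0)\<^sup>2" by (rule norm_add_Pythagorean)
      \<comment> \<open>Halving \<open>r\<close> multiplies the inductive bound by 4, and the
        correction adds \<open>3 / (12 * r^2)\<close>; the closed form solves this recursion, since
        \<open>4 * (4 ^ k - 1) + 3 = 4 ^ Suc k - 1\<close>.\<close>
      also have "\<dots> \<le> (4 ^ k - 1) / (12 * (r / 2)\<^sup>2) + 1 / (4 * r\<^sup>2)" using nx x0 by linarith
      also have "\<dots> = (4 ^ Suc k - 1) / (12 * r\<^sup>2)" using r by (simp add: field_simps power2_eq_square)
      finally show "(norm (x + x0))\<^sup>2 \<le> (4 ^ Suc k - 1) / (12 * r\<^sup>2)" .
    next
      have "x \<in> span M" using x(1) span_minimal[OF sub] by auto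
      then show "x + x0 \<in> span M" unfolding x0_def using v by (auto intro: span_add span_scale span_base)
    qed
  qed
qed

section \<open>Integer vectors and the inhomogeneous transference bound\<close>

lemma vec_of_int_nth [simp]: "vec_of_int y $ i = of_int (y $ i)"
  by (simp add: vec_of_int_def)

lemma vec_of_int_diff: "vec_of_int (y - z) = vec_of_int y - vec_of_int z"
  by (simp add: vec_eq_iff)

lemma vec_of_int_zero [simp]: "vec_of_int 0 = 0"
  by (simp add: vec_eq_iff)

lemma vec_of_int_eq_0_iff [simp]: "vec_of_int y = 0 \<longleftrightarrow> y = 0"
  by (simp add: vec_eq_iff)

lemma vec_of_int_axis: "vec_of_int (axis i k) = axis i (of_int k)"
  by (simp add: vec_eq_iff axis_def)

lemma dist_nearest_int_le: "dist_nearest_int x \<le> \<bar>x - of_int p\<bar>"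
  unfolding dist_nearest_int_def by (rule round_diff_minimal)

text \<open>Applying the character lemma to the rescaled dual lattice, with pairing against a target
  \<open>\<tau>\<close> as the character, yields a short \<open>x\<close> such that
  \<open>x - \<tau>\<close> pairs integrally with that lattice. Thus \<open>x - \<tau>\<close> is a
  rescaled point of the original lattice, and \<open>q\<close> can be read off from it. Hypothesis
  \<open>C\<close> makes \<open>x\<close> shorter than \<open>C / 2\<close>.\<close>

lemma transference_inhomogeneous:
  fixes \<Theta> :: "real ^ 'm ^ 'n" and a :: "'n::finite \<Rightarrow> real" and b :: "'m::finite \<Rightarrow> real"
    and \<eta> :: "real ^ 'n" and C :: real
  assumes a: "\<And>i. a i > 0" and b: "\<And>j. b j > 0" and C0: "C > 0"
    and C: "(4 ^ (CARD('n) + CARD('m)) - 1) / 12 < (C / 2)\<^sup>2"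
    and dual: "\<And>(y :: int ^ 'n) (z :: int ^ 'm). (\<And>i. \<bar>of_int (y $ i)\<bar> \<le> a i) \<Longrightarrow>
       (\<And>j. \<bar>(transpose \<Theta> *v vec_of_int y - vec_of_int z) $ j\<bar> * b j \<le> 1) \<Longrightarrow> y = 0 \<and> z = 0"
  shows "\<exists>q :: int ^ 'm. q \<noteq> 0 \<and>
     (\<forall>i. dist_nearest_int (row i \<Theta> \<bullet> vec_of_int q - \<eta> $ i) \<le> C / a i) \<and>
     (\<forall>j. \<bar>of_int (q $ j)\<bar> \<le> C * b j)"
proof -
  \<comment> \<open>The scaling turns the box of hypothesis \<open>dual\<close> into the unit cube.
    A norm below 1 bounds every coordinate by 1, so that hypothesis gives minimal norm at least
    1.\<close>
  define W :: "int ^ 'n \<Rightarrow> int ^ 'm \<Rightarrow> (real ^ 'n) \<times> (real ^ 'm)" where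
    "W y z = ((\<chi> i. of_int (y $ i) / a i),
              (\<chi> j. b j * (transpose \<Theta> *v vec_of_int y - vec_of_int z) $ j))" for y z
  define M where "M = {W y z | y z. True}"
  \<comment> \<open>Centring \<open>q\<close> at half the admissible box forces all its coordinates to be positive.\<close>
  define \<tau> :: "(real ^ 'n) \<times> (real ^ 'm)" where "\<tau> = ((\<chi> i. a i * \<eta> $ i), (\<chi> j. - C / 2))"
  have W_diff: "W y z - W y' z' = W (y - y') (z - z')" for y z y' z'
    by (simp add: W_def vec_eq_iff vec_of_int_diff matrix_vector_mult_diff_distrib
        diff_divide_distrib algebra_simps)
  have norm_ge: "1 \<le> norm w" if w0: "w \<in> M" "w \<noteq> 0" for w
  proof (rule ccontr)
    assume "\<not> 1 \<le> norm w"
    then have lt: "norm w < 1" by simp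
    obtain y z where w: "w = W y z" using w0 by (auto simp: M_def)
    have 1: "\<bar>fst w $ i\<bar> < 1" for i
      using component_le_norm_cart[of "fst w" i] norm_fst_le[of "fst w" "snd w"] lt by simp
    have 2: "\<bar>snd w $ j\<bar> < 1" for j
      using component_le_norm_cart[of "snd w" j] norm_snd_le[of "snd w" "fst w"] lt by simp
    have "y = 0 \<and> z = 0"
    proof (rule dual)
      show "\<bar>of_int (y $ i)\<bar> \<le> a i" for i
        using 1[of i] a[of i] by (simp add: w W_def field_simps)
      show "\<bar>(transpose \<Theta> *v vec_of_int y - vec_of_int z) $ j\<bar> * b j \<le> 1" for j
        using 2[of j] b[of j] by (simp add: w W_def abs_mult mult.commute)
    qed
    then have "w = W 0 0 - W 0 0" unfolding W_diff by (simp add: w)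
    then have "w = 0" by simp
    with w0 show False by simp
  qed
  have "\<exists>x\<in>span M. (\<forall>w\<in>M. x \<bullet> w - \<tau> \<bullet> w \<in> \<int>) \<and>
      (norm x)\<^sup>2 \<le> (4 ^ (CARD('n) + CARD('m)) - 1) / (12 * 1\<^sup>2)"
  proof (rule character_short_representative)
    show "0 \<in> M" using W_diff[of 0 0 0 0] unfolding M_def by force
    show "u - v \<in> M" if "u \<in> M" "v \<in> M" for u v
      using that unfolding M_def by (auto simp: W_diff) blast
    show "\<tau> \<bullet> (u - v) - (\<tau> \<bullet> u - \<tau> \<bullet> v) \<in> \<int>" for u v
      by (simp add: inner_diff_right)
    show "dim M \<le> CARD('n) + CARD('m)" using dim_subset_UNIV[of M] by simp
  qed (use norm_ge in auto)
  then obtain x where x: "\<And>y z. (x - \<tau>) \<bullet> W y z \<in> \<int>"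
    and x2: "(norm x)\<^sup>2 \<le> (4 ^ (CARD('n) + CARD('m)) - 1) / 12"
    unfolding M_def inner_diff_left power_one mult_1_right by blast
  from x2 have "(norm x)\<^sup>2 < (C / 2)\<^sup>2" using C by linarith
  then have nx: "norm x < C / 2" by (rule power2_less_imp_less) (use C0 in simp)
  have s: "\<bar>fst x $ i\<bar> < C / 2" for i
    using component_le_norm_cart[of "fst x" i] norm_fst_le[of "fst x" "snd x"] nx by simp
  have t: "\<bar>snd x $ j\<bar> < C / 2" for j
    using component_le_norm_cart[of "snd x" j] norm_snd_le[of "snd x" "fst x"] nx by simp
  \<comment> \<open>Pairing \<open>x - \<tau>\<close> with the image of the \<open>j\<close>-th unit
    vector in the \<open>z\<close> part isolates the coordinate that becomes
    \<open>q $ j\<close>.\<close>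
  have "b j * (snd x $ j + C / 2) \<in> \<int>" for j
  proof -
    have "(x - \<tau>) \<bullet> W 0 (axis j 1) = (\<Sum>k\<in>UNIV. (snd x $ k + C / 2) * (b k * - axis j 1 $ k))"
      by (simp add: W_def \<tau>_def inner_prod_def inner_vec_def vec_of_int_axis)
    also have "\<dots> = - (b j * (snd x $ j + C / 2))"
      by (simp add: axis_def if_distrib sum.delta cong: if_cong)
    finally show ?thesis using x[of 0 "axis j 1"] by (metis Ints_minus minus_minus)
  qed
  then have "\<exists>k::int. b j * (snd x $ j + C / 2) = of_int k" for j
    by (metis Ints_cases)
  then obtain Q :: "'m \<Rightarrow> int" where Q: "\<And>j. b j * (snd x $ j + C / 2) = of_int (Q j)" by metis
  define q :: "int ^ 'm" where "q = (\<chi> j. Q j)"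
  have qj: "of_int (q $ j) = b j * (snd x $ j + C / 2)" for j by (simp add: q_def Q)
  have qpos: "0 < real_of_int (q $ j)" for j
    unfolding qj using t[of j] b[of j] by (intro mult_pos_pos) auto
  show ?thesis
  proof (intro exI[of _ q] conjI allI)
    show "q \<noteq> 0" using qpos by force
    show "\<bar>of_int (q $ j)\<bar> \<le> C * b j" for j
    proof -
      have "b j * (snd x $ j + C / 2) \<le> b j * C" using t[of j] b[of j] by (intro mult_left_mono) auto
      then show ?thesis using qpos[of j] qj[of j] by (simp add: mult.commute)
    qed
    show "dist_nearest_int (row i \<Theta> \<bullet> vec_of_int q - \<eta> $ i) \<le> C / a i" for i
    proof -
      \<comment> \<open>Pairing with the image of a unit vector in the \<open>y\<close> part brings
        in the \<open>i\<close>-th row of \<open>\<Theta>\<close> evaluated at the \<open>q\<close>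
        just found, shifted by \<open>\<eta> $ i\<close> and by the small error
        \<open>fst x $ i / a i\<close>.\<close>
      have "(x - \<tau>) \<bullet> W (axis i 1) 0 =
          (\<Sum>k\<in>UNIV. (fst x $ k - a k * \<eta> $ k) * (axis i 1 $ k / a k)) +
          (\<Sum>j\<in>UNIV. (snd x $ j + C / 2) * (b j * \<Theta> $ i $ j))"
        by (simp add: W_def \<tau>_def inner_prod_def inner_vec_def vec_of_int_axis
            matrix_vector_mul_component transpose_def axis_def if_distrib cong: if_cong)
      also have "(\<Sum>k\<in>UNIV. (fst x $ k - a k * \<eta> $ k) * (axis i 1 $ k / a k)) =
          (\<Sum>k\<in>UNIV. if k = i then fst x $ k / a k - \<eta> $ k else 0)"
        using a by (intro sum.cong) (auto simp: axis_def field_simps less_imp_neq[symmetric])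
      also have "\<dots> = fst x $ i / a i - \<eta> $ i" by simp
      also have "(\<Sum>j\<in>UNIV. (snd x $ j + C / 2) * (b j * \<Theta> $ i $ j)) = row i \<Theta> \<bullet> vec_of_int q"
        by (simp add: inner_vec_def row_def qj mult_ac)
      finally have "fst x $ i / a i - \<eta> $ i + row i \<Theta> \<bullet> vec_of_int q \<in> \<int>"
        using x[of "axis i 1" 0] by simp
      then obtain p where "fst x $ i / a i - \<eta> $ i + row i \<Theta> \<bullet> vec_of_int q = of_int p"
        by (rule Ints_cases)
      then have "row i \<Theta> \<bullet> vec_of_int q - \<eta> $ i - of_int p = - (fst x $ i / a i)" by simp
      then have "dist_nearest_int (row i \<Theta> \<bullet> vec_of_int q - \<eta> $ i) \<le> \<bar>fst x $ i\<bar> / a i"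
        using dist_nearest_int_le[of "row i \<Theta> \<bullet> vec_of_int q - \<eta> $ i" p] a[of i] by simp
      also have "\<dots> \<le> C / a i" using s[of i] a[of i] C0 by (intro divide_right_mono) auto
      finally show ?thesis .
    qed
  qed
qed

section \<open>Weight functions, their inverses and weighted distances\<close>

lemma weight_function_reciprocal:
  assumes "weight_function h" "T > 0"
  shows "h (1 / T) = 1 / h T"
proof (cases "T \<le> 1")
  case True
  then show ?thesis using assms by (simp add: weight_function_def)
next
  case False
  then have "1 / T \<le> 1" "0 < 1 / T" by auto
  then have "h (1 / T) = 1 / h (1 / (1 / T))" using assms(1) unfolding weight_function_def by blast
  then show ?thesis by simp
qed

lemma weight_function_pos:
  assumes "weight_function h" "T > 0"
  shows "h T > 0"
  using strict_mono_onD[OF weight_function_strict_mono_on[OF assms(1)], of 0 T] assms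
  by (simp add: weight_function_def)

lemma weight_inv_weight:
  assumes "weight_function h" "X \<ge> 0"
  shows "weight_inv h (h X) = X"
  using weight_function_bij_betw[OF assms(1)] assms(2)
  by (simp add: weight_inv_def the_inv_into_f_f bij_betw_def)

lemma weight_inv_le:
  assumes "weight_function h" "X \<ge> 0" "0 \<le> t" "t \<le> h X"
  shows "weight_inv h t \<le> X"
  using weight_inv_mono[OF assms(1,3,4)] weight_inv_weight[OF assms(1,2)] by simp

lemma weight_inv_zero: "weight_function h \<Longrightarrow> weight_inv h 0 = 0"
  using weight_inv_weight[of h 0] by (simp add: weight_function_def)

lemma weight_inv_pos:
  assumes h: "weight_function h" and "t > 0"
  shows "weight_inv h t > 0"
proof -
  obtain X where X: "X \<ge> 0" "h X = t"
    using weight_function_bij_betw[OF h] assms(2) unfolding bij_betw_def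
    by (metis atLeast_iff image_iff less_imp_le)
  have "h 0 = 0" using h by (simp add: weight_function_def)
  then have "X \<noteq> 0" using X assms(2) by auto
  then show ?thesis using X weight_inv_weight[OF h, of X] by auto
qed

lemma weighted_abs_le_iff: "weighted_abs w y \<le> B \<longleftrightarrow> (\<forall>i. weight_inv (w i) \<bar>y $ i\<bar> \<le> B)"
  unfolding weighted_abs_def by (subst Max_le_iff) auto

lemma weighted_abs_pos:
  assumes w: "\<And>i. weight_function (w i)" and "y \<noteq> 0"
  shows "weighted_abs w y > 0"
proof -
  obtain i where "y $ i \<noteq> 0" using assms by (auto simp: vec_eq_iff)
  then have "0 < weight_inv (w i) \<bar>y $ i\<bar>" using w by (intro weight_inv_pos) auto
  also have "\<dots> \<le> weighted_abs w y" using weighted_abs_le_iff by blast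
  finally show ?thesis .
qed

lemma weighted_int_dist_le:
  assumes w: "\<And>i. weight_function (w i)"
  shows "weighted_int_dist w x \<le> weighted_abs w (x - vec_of_int p)"
  using weighted_int_dist_attained[of w x] w by metis

text \<open>The infimum is attained, so positivity of the individual \<open>weighted_abs\<close>
  values passes to it.\<close>

lemma weighted_int_dist_pos:
  assumes w: "\<And>i. weight_function (w i)" and "\<And>p. x \<noteq> vec_of_int p"
  shows "weighted_int_dist w x > 0"
proof -
  obtain p where "weighted_int_dist w x = weighted_abs w (x - vec_of_int p)"
    using weighted_int_dist_attained[of w x] w by metis
  then show ?thesis using weighted_abs_pos[of w "x - vec_of_int p"] assms by simp
qed

section \<open>From non-approximability to empty dual boxes\<close>

text \<open>Every positive multiple of \<open>y\<close> also has an integral image, hence distance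
  0, which lies below the positive values of \<open>f\<close>.\<close>

lemma weighted_approximable_of_integral:
  fixes A :: "real ^ 'n ^ 'm" and y :: "int ^ 'n"
  assumes \<alpha>: "\<And>i. weight_function (\<alpha> i)" and \<beta>: "\<And>j. weight_function (\<beta> j)"
    and f_pos: "f ` {0<..} \<subseteq> {0<..}"
    and y: "y \<noteq> 0" and p: "A *v vec_of_int y = vec_of_int p"
  shows "weighted_approximable f \<beta> \<alpha> A"
proof -
  \<comment> \<open>\<open>Suc k\<close> rather than \<open>k\<close> keeps the zero vector out of
    the family.\<close>
  define Y :: "nat \<Rightarrow> int ^ 'n" where "Y k = (\<chi> i. int (Suc k) * y $ i)" for k
  obtain i where i: "y $ i \<noteq> 0" using y by (auto simp: vec_eq_iff)
  have "inj Y"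
  proof (rule injI)
    fix k l assume "Y k = Y l"
    then have "Y k $ i = Y l $ i" by simp
    then show "k = l" using i by (simp add: Y_def)
  qed
  then have "infinite (range Y)" by (rule range_inj_infinite)
  moreover have "Y k \<noteq> 0 \<and> weighted_int_dist \<beta> (A *v vec_of_int (Y k)) \<le> f (weighted_abs \<alpha> (vec_of_int (Y k)))"
    for k
  proof
    show nz: "Y k \<noteq> 0" using i by (auto simp: Y_def vec_eq_iff)
    have "vec_of_int (Y k) = real (Suc k) *\<^sub>R vec_of_int y"
      by (simp add: Y_def vec_eq_iff)
    then have "A *v vec_of_int (Y k) = real (Suc k) *\<^sub>R vec_of_int p"
      using p by (simp add: matrix_vector_mult_scaleR)
    then have eq: "A *v vec_of_int (Y k) = vec_of_int (\<chi> j. int (Suc k) * p $ j)"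
      by (simp add: vec_eq_iff)
    have "weighted_int_dist \<beta> (A *v vec_of_int (Y k)) \<le> weighted_abs \<beta> 0"
      using weighted_int_dist_le[of \<beta> "A *v vec_of_int (Y k)" "\<chi> j. int (Suc k) * p $ j"] \<beta> eq by simp
    also have "\<dots> \<le> 0" using weight_inv_zero \<beta> by (simp add: weighted_abs_le_iff)
    also have "0 \<le> f (weighted_abs \<alpha> (vec_of_int (Y k)))"
      using weighted_abs_pos[of \<alpha> "vec_of_int (Y k)"] \<alpha> nz f_pos by (force intro: less_imp_le)
    finally show "weighted_int_dist \<beta> (A *v vec_of_int (Y k)) \<le> f (weighted_abs \<alpha> (vec_of_int (Y k)))" .
  qed
  ultimately show ?thesis
    unfolding weighted_approximable_def by (elim infinite_super[rotated]) auto
qed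

text \<open>A nonzero \<open>y\<close> in the box would be one of the finitely many solutions. Each
  of these has a positive distance, which exceeds \<open>1 / T\<close> once \<open>T\<close> is
  large, whereas the box demands distance at most \<open>1 / T\<close>.\<close>

lemma not_approximable_dual_box_empty:
  fixes A :: "real ^ 'n ^ 'm"
  assumes \<alpha>: "\<And>i. weight_function (\<alpha> i)" and \<beta>: "\<And>j. weight_function (\<beta> j)"
    and f_pos: "f ` {0<..} \<subseteq> {0<..}" and f_decr: "strict_antimono_on {0<..} f"
    and not_approx: "\<not> weighted_approximable f \<beta> \<alpha> A"
  shows "\<forall>\<^sub>F T in at_top. \<forall>X>0. f X = 1 / T \<longrightarrow> (\<forall>(y :: int ^ 'n) (z :: int ^ 'm).
    (\<forall>i. \<bar>of_int (y $ i)\<bar> \<le> \<alpha> i X) \<longrightarrow>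
    (\<forall>j. \<bar>(A *v vec_of_int y - vec_of_int z) $ j\<bar> * \<beta> j T \<le> 1) \<longrightarrow> y = 0 \<and> z = 0)"
proof -
  define B where "B = {y :: int ^ 'n. y \<noteq> 0 \<and>
    weighted_int_dist \<beta> (A *v vec_of_int y) \<le> f (weighted_abs \<alpha> (vec_of_int y))}"
  have "finite B" using not_approx by (simp add: weighted_approximable_def B_def)
  moreover have "\<forall>\<^sub>F T in at_top. 1 / T < weighted_int_dist \<beta> (A *v vec_of_int y)" if "y \<in> B" for y
  proof -
    have "weighted_int_dist \<beta> (A *v vec_of_int y) > 0"
      using weighted_approximable_of_integral[of \<alpha> \<beta> f y A] that not_approx \<alpha> \<beta> f_pos
      by (intro weighted_int_dist_pos) (auto simp: B_def)
    moreover have "((\<lambda>T::real. 1 / T) \<longlongrightarrow> 0) at_top"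
      using tendsto_inverse_0_at_top[OF filterlim_ident] by (simp add: inverse_eq_divide)
    ultimately show ?thesis by (rule order_tendstoD(2)[rotated])
  qed
  ultimately have "\<forall>\<^sub>F T in at_top. \<forall>y\<in>B. 1 / T < weighted_int_dist \<beta> (A *v vec_of_int y)"
    by (intro eventually_ball_finite) auto
  then show ?thesis
    \<comment> \<open>\<open>T > 1\<close> makes every \<open>\<beta> j T\<close> exceed 1, which
      rules out a nonzero \<open>z\<close> once \<open>y = 0\<close>.\<close>
    using eventually_gt_at_top[of 1]
  proof eventually_elim
    case (elim T)
    show ?case
    proof (intro allI impI)
      fix X and y :: "int ^ 'n" and z :: "int ^ 'm"
      assume X: "0 < X" "f X = 1 / T"
        and y: "\<forall>i. \<bar>of_int (y $ i)\<bar> \<le> \<alpha> i X"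
        and z: "\<forall>j. \<bar>(A *v vec_of_int y - vec_of_int z) $ j\<bar> * \<beta> j T \<le> 1"
      have \<beta>T: "\<beta> j T > 1" for j
        using strict_mono_onD[OF weight_function_strict_mono_on[OF \<beta>[of j]], of 1 T] \<beta>[of j] elim
        by (simp add: weight_function_def)
      have "y = 0"
      proof (rule ccontr)
        assume nz: "y \<noteq> 0"
        let ?Y = "weighted_abs \<alpha> (vec_of_int y)"
        have pos: "0 < ?Y" using \<alpha> nz by (intro weighted_abs_pos) auto
        have "?Y \<le> X" using y \<alpha> X by (auto simp: weighted_abs_le_iff intro!: weight_inv_le)
        \<comment> \<open>A smaller argument gives a larger value of \<open>f\<close>; strict
          monotonicity leaves equality of the arguments as a separate case.\<close>
        then have fY: "1 / T \<le> f ?Y"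
          using pos X f_decr[unfolded monotone_on_def, rule_format, of ?Y X] by (cases "?Y = X") auto
        have "weighted_int_dist \<beta> (A *v vec_of_int y) \<le> weighted_abs \<beta> (A *v vec_of_int y - vec_of_int z)"
          using \<beta> by (intro weighted_int_dist_le)
        also have "\<dots> \<le> 1 / T"
          unfolding weighted_abs_le_iff
        proof
          fix j
          have "\<bar>(A *v vec_of_int y - vec_of_int z) $ j\<bar> \<le> 1 / \<beta> j T"
            using z \<beta>T[of j] by (simp add: field_simps)
          also have "\<dots> = \<beta> j (1 / T)" using weight_function_reciprocal[OF \<beta>[of j], of T] elim by simp
          finally show "weight_inv (\<beta> j) \<bar>(A *v vec_of_int y - vec_of_int z) $ j\<bar> \<le> 1 / T"
            using elim by (intro weight_inv_le \<beta>) auto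
        qed
        finally have le: "weighted_int_dist \<beta> (A *v vec_of_int y) \<le> 1 / T" .
        then have "y \<in> B" using fY nz by (auto simp: B_def)
        with elim le show False by force
      qed
      moreover have "z = 0"
      proof -
        have "z $ j = 0" for j
        proof (rule ccontr)
          assume "z $ j \<noteq> 0"
          then have "1 \<le> \<bar>real_of_int (z $ j)\<bar>" by linarith
          then have "1 * \<beta> j T \<le> \<bar>real_of_int (z $ j)\<bar> * \<beta> j T"
            using \<beta>T[of j] by (intro mult_right_mono) auto
          also have "\<dots> \<le> 1" using z[rule_format, of j] \<open>y = 0\<close> by simp
          finally show False using \<beta>T[of j] by simp
        qed
        then show ?thesis by (simp add: vec_eq_iff)
      qed
      ultimately show "y = 0 \<and> z = 0" ..
    qed
  qed
qed

section \<open>The constant and the final deduction\<close>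

text \<open>The inequality fails at \<open>d = 1\<close>, so the induction starts at 2, where both
  sides equal 4.\<close>

lemma two_power_le_mult_fact:
  assumes "d \<ge> 2"
  shows "2 ^ d \<le> real d * fact d"
  using assms
proof (induction d rule: dec_induct)
  case base
  then show ?case by (simp add: fact_numeral)
next
  case (step d)
  have "2 * 2 ^ d \<le> real (Suc d) * (real d * fact d)" using step by (intro mult_mono) auto
  also have "\<dots> \<le> real (Suc d) * (real (Suc d) * fact d)"
    by (intro mult_left_mono mult_right_mono) auto
  finally show ?case by (simp add: mult_ac)
qed

theorem theorem1p2:
  fixes \<Theta> :: "real ^ 'm ^ 'n"
    and \<alpha> :: "'n::finite \<Rightarrow> real \<Rightarrow> real"
    and \<beta> :: "'m::finite \<Rightarrow> real \<Rightarrow> real"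
    and f g :: "real \<Rightarrow> real"
    and d :: nat and C :: real
  assumes d: "d = CARD('n) + CARD('m)"
    and C: "C = real d * fact d"
    and \<alpha>: "\<And>i. weight_function (\<alpha> i)"
    and \<beta>: "\<And>j. weight_function (\<beta> j)"
    and f_pos: "f ` {0<..} \<subseteq> {0<..}"
    and f_cont: "continuous_on {0<..} f"
    and f_decr: "strict_antimono_on {0<..} f"
    and g: "\<And>T. T \<in> dual_dom f \<Longrightarrow> g T = dual_fun f T"
    and not_approx: "\<not> weighted_approximable f \<beta> \<alpha> (transpose \<Theta>)"
  shows "(\<forall>\<eta> :: real ^ 'n. \<forall>\<^sub>F T in at_top. T \<in> dual_dom f \<longrightarrow>
           (\<exists>q :: int ^ 'm. q \<noteq> 0 \<and>
              (\<forall>i. dist_nearest_int (row i \<Theta> \<bullet> vec_of_int q - \<eta> $ i) \<le> C * \<alpha> i (g T)) \<and>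
              (\<forall>j. \<bar>of_int (q $ j)\<bar> \<le> C * \<beta> j T)))
       \<and> {\<eta>. weighted_dirichlet (dual_dom f) g (\<lambda>i T. C * \<alpha> i T) (\<lambda>j T. C * \<beta> j T) \<Theta> \<eta>} = UNIV"
proof -
  have "CARD('n) > 0" "CARD('m) > 0" by (auto simp: card_gt_0_iff)
  then have d2: "d \<ge> 2" using d by linarith
  then have Cpow: "2 ^ d \<le> C" unfolding C by (rule two_power_le_mult_fact)
  moreover have "0 < (2::real) ^ d" by simp
  ultimately have C0: "C > 0" by linarith
  \<comment> \<open>The squared covering bound is below \<open>4 ^ d / 12\<close>, and
    \<open>2 ^ d \<le> C\<close> places this below \<open>(C / 2)^2\<close>.\<close>
  have "(4::real) ^ d = (2 ^ d)\<^sup>2" by (simp add: power2_eq_square flip: power_mult_distrib)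
  also have "\<dots> \<le> C\<^sup>2" using Cpow by (intro power_mono) auto
  finally have "4 ^ d \<le> C\<^sup>2" .
  moreover have "(u - 1) / 12 < v / 4" if "u \<le> v" "0 < v" for u v :: real
    using that by (simp add: field_simps)
  ultimately have "(4 ^ d - 1) / 12 < C\<^sup>2 / 4"
    using zero_less_power[OF C0] by metis
  then have Cbound: "(4 ^ (CARD('n) + CARD('m)) - 1) / 12 < (C / 2)\<^sup>2"
    by (simp add: d power_divide)
  have inj: "inj_on f {0<..}"
  proof (rule inj_onI)
    fix x y :: real assume "x \<in> {0<..}" "y \<in> {0<..}" "f x = f y"
    then show "x = y"
      using f_decr[unfolded monotone_on_def, rule_format, of x y]
        f_decr[unfolded monotone_on_def, rule_format, of y x] by (cases x y rule: linorder_cases) auto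
  qed
  have main: "\<forall>\<^sub>F T in at_top. T \<in> dual_dom f \<longrightarrow>
      (\<exists>q :: int ^ 'm. q \<noteq> 0 \<and>
         (\<forall>i. dist_nearest_int (row i \<Theta> \<bullet> vec_of_int q - \<eta> $ i) \<le> C * \<alpha> i (g T)) \<and>
         (\<forall>j. \<bar>of_int (q $ j)\<bar> \<le> C * \<beta> j T))" for \<eta> :: "real ^ 'n"
    \<comment> \<open>The threshold for \<open>T\<close> comes from a statement without
      \<open>\<eta>\<close>, so one threshold serves all targets.\<close>
    using not_approximable_dual_box_empty[OF \<alpha> \<beta> f_pos f_decr not_approx]
  proof eventually_elim
    case (elim T)
    show ?case
    proof
      assume T: "T \<in> dual_dom f"
      then obtain X where X: "X > 0" "f X = 1 / T" and T0: "T > 0" by (auto simp: dual_dom_def)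
      have "g T = 1 / X"
        using g[OF T] the_inv_into_f_f[OF inj, of X] X by (simp add: dual_fun_def)
      \<comment> \<open>The reciprocal symmetry of weights turns the bound
        \<open>C / \<alpha> i X\<close> of the transference into
        \<open>C * \<alpha> i (g T)\<close>.\<close>
      then have gT: "\<alpha> i (g T) = 1 / \<alpha> i X" for i
        using weight_function_reciprocal[OF \<alpha>] X by simp
      have "\<exists>q :: int ^ 'm. q \<noteq> 0 \<and>
         (\<forall>i. dist_nearest_int (row i \<Theta> \<bullet> vec_of_int q - \<eta> $ i) \<le> C / \<alpha> i X) \<and>
         (\<forall>j. \<bar>of_int (q $ j)\<bar> \<le> C * \<beta> j T)"
      proof (rule transference_inhomogeneous)
        show "\<alpha> i X > 0" for i using \<alpha> X(1) by (rule weight_function_pos)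
        show "\<beta> j T > 0" for j using \<beta> T0 by (rule weight_function_pos)
        show "C > 0" "(4 ^ (CARD('n) + CARD('m)) - 1) / 12 < (C / 2)\<^sup>2" by fact+
        show "y = 0 \<and> z = 0" if "\<And>i. \<bar>of_int (y $ i)\<bar> \<le> \<alpha> i X"
          "\<And>j. \<bar>(transpose \<Theta> *v vec_of_int y - vec_of_int z) $ j\<bar> * \<beta> j T \<le> 1"
          for y :: "int ^ 'n" and z :: "int ^ 'm"
          using elim[rule_format, OF X that] .
      qed
      then show "\<exists>q :: int ^ 'm. q \<noteq> 0 \<and>
         (\<forall>i. dist_nearest_int (row i \<Theta> \<bullet> vec_of_int q - \<eta> $ i) \<le> C * \<alpha> i (g T)) \<and>
         (\<forall>j. \<bar>of_int (q $ j)\<bar> \<le> C * \<beta> j T)"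
        by (simp add: gT)
    qed
  qed
  moreover have "(\<Theta> *v x) $ i = row i \<Theta> \<bullet> x" for x i
    by (simp add: matrix_vector_mul_component row_def)
  ultimately show ?thesis by (simp add: weighted_dirichlet_def)
qed

end
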